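(* Let $(X,d)$ be a nonempty compact metric space and $f:X\to X$ a homeomorphism. Assume that $(X,f)$ is equicontinuous. Then the following are equivalent: (1) $(X,f)$ is topologically transitive; (2) $(X,f)$ is minimal; (3) $(X,f)$ has the gluing orbit property.
   Context: $(X,f)$ is equicontinuous if for every $\varepsilon>0$ there is $\delta>0$ such that for any $x,y\in X$ with $d(x,y)<\delta$ we have $d(f^n(x),f^n(y))<\varepsilon$ for every $n\ge0$. $(X,f)$ is topologically transitive if for any nonempty open sets $U,V$ in $X$ there is $n\in\mathbb{Z}$ such that $U\cap f^{-n}(V)\neq\emptyset$. $(X,f)$ is minimal if for every $x\in X$ the full orbit $\{f^n(x):n\in\mathbb{Z}\}$ is dense in $X$. Gluing orbit property. An orbit sequence of rank $k$ ($k\ge 1$) is a finite sequence $\mathscr{C}=\{(x_j,m_j)\in X\times\mathbb{Z}^+: j=1,\dots,k\}$, where $\mathbb{Z}^+=\{1,2,\dots\}$. A gap for it is a $(k-1)$-tuple $\mathscr{G}=\{t_j\in\mathbb{Z}^+: j=1,\dots,k-1\}$ (empty if $k=1$). For $\varepsilon>0$, $(\mathscr{C},\mathscr{G})$ is $\varepsilon$-shadowed by $z\in X$ if for every $j=1,\dots,k$, $d(f^{s_j+l}(z),f^l(x_j))<\varepsilon$ for every $l=0,1,\dots,m_j-1$, where $s_1=0$ and $s_j=\sum_{i=1}^{j-1}(m_i+t_i-1)$ for $j=2,\dots,k$. $(X,f)$ has the gluing orbit property if for every $\varepsilon>0$ there is $M(\varepsilon)>0$ such that for any orbit sequence $\mathscr{C}$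 there is a gap $\mathscr{G}$ with $\max\mathscr{G}\le M(\varepsilon)$ such that $(\mathscr{C},\mathscr{G})$ can be $\varepsilon$-shadowed by some $z\in X$. *)

theory Defs
  imports "HOL-Analysis.Analysis"
begin

text \<open>
  A dynamical system is given by a carrier set \<open>X\<close> with a distance \<open>d\<close> and a map \<open>f\<close>. All
  definitions below are meant for the case that \<open>Metric_space X d\<close> holds and \<open>f\<close> is a
  homeomorphism of \<open>X\<close>; the values of \<open>d\<close> and \<open>f\<close> outside \<open>X\<close> are irrelevant.
\<close>

definition int_iter :: "'a set \<Rightarrow> ('a \<Rightarrow> 'a) \<Rightarrow> int \<Rightarrow> 'a \<Rightarrow> 'a" where
  "int_iter X f n = (if 0 \<le> n then f ^^ nat n else inv_into X f ^^ nat (- n))"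

definition equicontinuous_system :: "'a set \<Rightarrow> ('a \<Rightarrow> 'a \<Rightarrow> real) \<Rightarrow> ('a \<Rightarrow> 'a) \<Rightarrow> bool" where
  "equicontinuous_system X d f \<longleftrightarrow>
     (\<forall>\<epsilon>>0. \<exists>\<delta>>0. \<forall>x\<in>X. \<forall>y\<in>X. d x y < \<delta> \<longrightarrow> (\<forall>n. d ((f ^^ n) x) ((f ^^ n) y) < \<epsilon>))"

definition topologically_transitive :: "'a set \<Rightarrow> ('a \<Rightarrow> 'a \<Rightarrow> real) \<Rightarrow> ('a \<Rightarrow> 'a) \<Rightarrow> bool" where
  "topologically_transitive X d f \<longleftrightarrow>
     (\<forall>U V. openin (Metric_space.mtopology X d) U \<and> U \<noteq> {} \<and>
            openin (Metric_space.mtopology X d) V \<and> V \<noteq> {} \<longrightarrow>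
        (\<exists>n::int. U \<inter> {x \<in> X. int_iter X f n x \<in> V} \<noteq> {}))"

definition minimal_system :: "'a set \<Rightarrow> ('a \<Rightarrow> 'a \<Rightarrow> real) \<Rightarrow> ('a \<Rightarrow> 'a) \<Rightarrow> bool" where
  "minimal_system X d f \<longleftrightarrow>
     (\<forall>x\<in>X. Metric_space.mtopology X d closure_of range (\<lambda>n::int. int_iter X f n x) = X)"

text \<open>
  An orbit sequence of rank \<open>k\<close> is a pair of functions \<open>x\<close>, \<open>m\<close> and a gap is a function \<open>t\<close>; only
  the values \<open>x j\<close>, \<open>m j\<close> for \<open>j \<in> {1..k}\<close> and \<open>t j\<close> for \<open>j \<in> {1..<k}\<close> matter.
\<close>

definition orbit_sequence :: "'a set \<Rightarrow> nat \<Rightarrow> (nat \<Rightarrow> 'a) \<Rightarrow> (nat \<Rightarrow> nat) \<Rightarrow> bool" where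
  "orbit_sequence X k x m \<longleftrightarrow> 1 \<le> k \<and> (\<forall>j\<in>{1..k}. x j \<in> X \<and> 1 \<le> m j)"

definition is_gap :: "nat \<Rightarrow> (nat \<Rightarrow> nat) \<Rightarrow> bool" where
  "is_gap k t \<longleftrightarrow> (\<forall>j\<in>{1..<k}. 1 \<le> t j)"

text \<open>
  For \<open>j = 1\<close> the sum is empty. The subtraction on natural numbers does not truncate, since the
  lengths and gaps are positive.
\<close>

definition start_time :: "(nat \<Rightarrow> nat) \<Rightarrow> (nat \<Rightarrow> nat) \<Rightarrow> nat \<Rightarrow> nat" where
  "start_time m t j = (\<Sum>i\<in>{1..<j}. m i + t i - 1)"

definition shadowed_by ::
  "('a \<Rightarrow> 'a \<Rightarrow> real) \<Rightarrow> ('a \<Rightarrow> 'a) \<Rightarrow> real \<Rightarrow>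
   nat \<Rightarrow> (nat \<Rightarrow> 'a) \<Rightarrow> (nat \<Rightarrow> nat) \<Rightarrow> (nat \<Rightarrow> nat) \<Rightarrow> 'a \<Rightarrow> bool" where
  "shadowed_by d f \<epsilon> k x m t z \<longleftrightarrow>
     (\<forall>j\<in>{1..k}. \<forall>l<m j. d ((f ^^ (start_time m t j + l)) z) ((f ^^ l) (x j)) < \<epsilon>)"

definition gluing_orbit_property :: "'a set \<Rightarrow> ('a \<Rightarrow> 'a \<Rightarrow> real) \<Rightarrow> ('a \<Rightarrow> 'a) \<Rightarrow> bool" where
  "gluing_orbit_property X d f \<longleftrightarrow>
     (\<forall>\<epsilon>>0. \<exists>M::real. M > 0 \<and>
        (\<forall>k x m. orbit_sequence X k x m \<longrightarrow>
           (\<exists>t. is_gap k t \<and> (\<forall>j\<in>{1..<k}. real (t j) \<le> M) \<and>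
                (\<exists>z\<in>X. shadowed_by d f \<epsilon> k x m t z))))"

end

theory Submission
  imports Defs
begin

text \<open>
  All three properties are equivalent to one statement: every forward orbit comes arbitrarily close
  to every point.

  The link between full orbits and forward orbits is recurrence. Among the
  backward iterates of \<open>x\<close>, total boundedness yields two, far apart in time, that are close to each
  other; pushing them forward to time zero keeps them close by equicontinuity, and so some late
  iterate of \<open>x\<close> returns near \<open>x\<close>. Hence being approached by a forward orbit is a symmetric
  relation (\<open>reaches_sym\<close>), and a transit in negative time, as allowed by topological transitivity,
  can be traded for one in positive time (\<open>transitive_imp_all_reach\<close>).

  For the gluing orbit property, a finite net shows that the waiting time in the statement above is
  bounded uniformly over all pairs of points (\<open>uniform_waiting_time\<close>). The shadowing point can then
  be taken to be the first point \<open>x\<^sub>1\<close> of the orbit sequence itself: after each segment one waits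
  until the orbit of \<open>x\<^sub>1\<close> is close to the start of the next segment, and equicontinuity keeps it close for
  the whole segment. Errors do not accumulate, because each segment is compared directly with the
  true orbit of \<open>x\<^sub>1\<close>. Conversely, gluing two segments of length one gives a transit between
  neighbourhoods of any two points.
\<close>

section \<open>Equicontinuous surjections and recurrence\<close>

locale equicontinuous_surjection = Metric_space X d for X :: "'a set" and d +
  fixes f :: "'a \<Rightarrow> 'a"
  assumes totally_bounded: "mtotally_bounded X"
    and surj: "f ` X = X"
    and equicont: "equicontinuous_system X d f"
begin

text \<open>
  For \<open>x\<close> and \<open>y\<close> in \<open>X\<close> this says that \<open>y\<close> lies in the closure of the forward orbit of \<open>x\<close>.
\<close>
definition reaches :: "'a \<Rightarrow> 'a \<Rightarrow> bool" where
  "reaches x y \<longleftrightarrow> (\<forall>\<epsilon>>0. \<exists>n. d ((f ^^ n) x) y < \<epsilon>)"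

lemma iterate_in [simp]: "x \<in> X \<Longrightarrow> (f ^^ n) x \<in> X"
  using surj by (induction n) auto

lemma backward_iterate:
  assumes "x \<in> X"
  shows "(inv_into X f ^^ n) x \<in> X \<and> (f ^^ n) ((inv_into X f ^^ n) x) = x"
proof (induction n)
  case 0
  then show ?case using assms by simp
next
  case (Suc n)
  let ?y = "(inv_into X f ^^ n) x"
  have "?y \<in> f ` X" using Suc surj by simp
  then have "inv_into X f ?y \<in> X" "f (inv_into X f ?y) = ?y"
    by (simp_all add: inv_into_into f_inv_into_f)
  then show ?case using Suc by (simp add: funpow_swap1)
qed

lemma equicontE:
  assumes "\<epsilon> > 0"
  obtains \<delta> where "\<delta> > 0" "\<delta> \<le> \<epsilon>"
    "\<And>x y n. \<lbrakk>x \<in> X; y \<in> X; d x y < \<delta>\<rbrakk> \<Longrightarrow> d ((f ^^ n) x) ((f ^^ n) y) < \<epsilon>"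
proof -
  obtain \<delta> where "\<delta> > 0"
    "\<forall>x\<in>X. \<forall>y\<in>X. d x y < \<delta> \<longrightarrow> (\<forall>n. d ((f ^^ n) x) ((f ^^ n) y) < \<epsilon>)"
    using equicont assms unfolding equicontinuous_system_def by blast
  then show thesis using assms by (intro that[of "min \<delta> \<epsilon>"]) auto
qed

text \<open>
  Recurrence is extracted from the backward orbit: two close points \<open>f\<^sup>-\<^sup>i x\<close> and \<open>f\<^sup>-\<^sup>j x\<close> with
  \<open>i < j\<close> are mapped by \<open>f\<^sup>j\<close> to \<open>f\<^sup>j\<^sup>-\<^sup>i x\<close> and \<open>x\<close>. With two close points of the forward orbit one
  would have to pull back, which forward equicontinuity does not control directly.
\<close>

lemma late_return:
  assumes x: "x \<in> X" and "\<epsilon> > 0"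
  obtains m where "N \<le> m" "d ((f ^^ m) x) x < \<epsilon>"
proof -
  obtain \<delta> where \<delta>: "\<delta> > 0"
    "\<And>x y n. \<lbrakk>x \<in> X; y \<in> X; d x y < \<delta>\<rbrakk> \<Longrightarrow> d ((f ^^ n) x) ((f ^^ n) y) < \<epsilon>"
    using equicontE[OF \<open>\<epsilon> > 0\<close>] by metis
  define b where "b k = (inv_into X f ^^ k) x" for k
  have b: "b k \<in> X" "(f ^^ k) (b k) = x" for k
    using backward_iterate[OF x] by (auto simp: b_def)
  obtain K where K: "finite K" "K \<subseteq> X" "X \<subseteq> (\<Union>p\<in>K. mball p (\<delta>/2))"
    using totally_bounded \<open>\<delta> > 0\<close> unfolding mtotally_bounded_def by (meson half_gt_zero)
  have "\<exists>p\<in>K. b k \<in> mball p (\<delta>/2)" for k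
    using K(3) b(1)[of k] by blast
  then obtain p where p: "p k \<in> K" "b k \<in> mball (p k) (\<delta>/2)" for k
    by metis
  have "finite (range p)"
    using p(1) K(1) by (meson finite_subset image_subsetI)
  then obtain i where "infinite {k. p k = p i}"
    using pigeonhole_infinite[of UNIV p] by auto
  then obtain j where j: "i + N \<le> j" "p j = p i"
    by (auto simp: infinite_nat_iff_unbounded_le)
  have "d (b i) (b j) \<le> d (p i) (b i) + d (p i) (b j)"
    using triangle[of "b i" "p i" "b j"] p[of i] b(1)[of j] by (simp add: commute)
  also have "\<dots> < \<delta>"
    using p(2)[of i] p(2)[of j] j(2) by simp
  finally have "d ((f ^^ j) (b i)) ((f ^^ j) (b j)) < \<epsilon>"
    using \<delta>(2) b(1) by blast
  moreover have "(f ^^ j) (b i) = (f ^^ (j - i)) x"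
    using funpow_add[of "j - i" i f] j(1) b(2)[of i] by simp
  ultimately show thesis
    using that[of "j - i"] j(1) b(2)[of j] by simp
qed

lemma reaches_sym:
  assumes xy: "x \<in> X" "y \<in> X" and "reaches x y"
  shows "reaches y x"
  unfolding reaches_def
proof (intro allI impI)
  fix \<epsilon> :: real
  assume "\<epsilon> > 0"
  then obtain \<delta> where \<delta>: "\<delta> > 0"
    "\<And>x y n. \<lbrakk>x \<in> X; y \<in> X; d x y < \<delta>\<rbrakk> \<Longrightarrow> d ((f ^^ n) x) ((f ^^ n) y) < \<epsilon>/2"
    using equicontE[of "\<epsilon>/2"] by (metis half_gt_zero)
  obtain n where n: "d ((f ^^ n) x) y < \<delta>"
    using \<open>reaches x y\<close> \<open>\<delta> > 0\<close> unfolding reaches_def by blast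
  obtain m where m: "n \<le> m" "d ((f ^^ m) x) x < \<epsilon>/2"
    using late_return[OF \<open>x \<in> X\<close>, of "\<epsilon>/2" n] \<open>\<epsilon> > 0\<close> by auto
  have "d ((f ^^ (m - n)) ((f ^^ n) x)) ((f ^^ (m - n)) y) < \<epsilon>/2"
    using \<delta>(2) n xy by simp
  moreover have "(f ^^ (m - n)) ((f ^^ n) x) = (f ^^ m) x"
    using funpow_add[of "m - n" n f] m(1) by simp
  ultimately have "d ((f ^^ (m - n)) y) x < \<epsilon>"
    using m(2) triangle[of "(f ^^ (m - n)) y" "(f ^^ m) x" x] xy by (simp add: commute)
  then show "\<exists>n. d ((f ^^ n) y) x < \<epsilon>" by blast
qed

text \<open>
  It is enough that some nearby point travels near the target: the error in the starting point is
  absorbed by equicontinuity. This form fits both topological transitivity and gluing.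
\<close>

lemma reachesI_nearby:
  assumes xy: "x \<in> X" "y \<in> X"
    and nearby: "\<And>\<delta>. \<delta> > 0 \<Longrightarrow> \<exists>z\<in>X. \<exists>n. d x z < \<delta> \<and> d ((f ^^ n) z) y < \<delta>"
  shows "reaches x y"
  unfolding reaches_def
proof (intro allI impI)
  fix \<epsilon> :: real
  assume "\<epsilon> > 0"
  then obtain \<delta> where \<delta>: "\<delta> > 0" "\<delta> \<le> \<epsilon>/2"
    "\<And>x y n. \<lbrakk>x \<in> X; y \<in> X; d x y < \<delta>\<rbrakk> \<Longrightarrow> d ((f ^^ n) x) ((f ^^ n) y) < \<epsilon>/2"
    using equicontE[of "\<epsilon>/2"] by (metis half_gt_zero)
  obtain z n where zn: "z \<in> X" "d x z < \<delta>" "d ((f ^^ n) z) y < \<delta>"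
    using nearby[OF \<open>\<delta> > 0\<close>] by blast
  have "d ((f ^^ n) x) ((f ^^ n) z) < \<epsilon>/2"
    using \<delta>(3) zn xy by simp
  then have "d ((f ^^ n) x) y < \<epsilon>"
    using triangle[of "(f ^^ n) x" "(f ^^ n) z" y] zn xy \<delta>(2) by simp
  then show "\<exists>n. d ((f ^^ n) x) y < \<epsilon>" by blast
qed

section \<open>Transitivity and minimality\<close>

lemma transitive_imp_all_reach:
  assumes trans: "topologically_transitive X d f" and xy: "x \<in> X" "y \<in> X"
  shows "reaches x y"
proof -
  have transit: "(\<exists>z\<in>X. \<exists>n. d x z < \<delta> \<and> d ((f ^^ n) z) y < \<delta>) \<or>
      (\<exists>z\<in>X. \<exists>n. d y z < \<delta> \<and> d ((f ^^ n) z) x < \<delta>)" if "\<delta> > 0" for \<delta>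
  proof -
    have "mball x \<delta> \<noteq> {}" "mball y \<delta> \<noteq> {}"
      using xy that by auto
    then obtain n where "mball x \<delta> \<inter> {z \<in> X. int_iter X f n z \<in> mball y \<delta>} \<noteq> {}"
      using trans[unfolded topologically_transitive_def, rule_format, of "mball x \<delta>" "mball y \<delta>"]
        openin_mball by blast
    then obtain z where "z \<in> mball x \<delta>" "int_iter X f n z \<in> mball y \<delta>"
      by blast
    then have z: "z \<in> X" "d x z < \<delta>" "int_iter X f n z \<in> mball y \<delta>"
      by simp_all
    show ?thesis
    proof (cases "0 \<le> n")
      case True
      then show ?thesis using z by (auto simp: int_iter_def commute)
    next
      case False
      let ?w = "(inv_into X f ^^ nat (- n)) z"
      have "?w \<in> X" "(f ^^ nat (- n)) ?w = z" "d y ?w < \<delta>"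
        using backward_iterate[OF \<open>z \<in> X\<close>] z(3) False by (auto simp: int_iter_def)
      then show ?thesis using z(2) by (metis commute)
    qed
  qed
  \<comment> \<open>If forward transits fail at one scale, then at every smaller scale the transit must go from
    \<open>y\<close> to \<open>x\<close>, and symmetry applies.\<close>
  show ?thesis
  proof (cases "\<forall>\<delta>>0. \<exists>z\<in>X. \<exists>n. d x z < \<delta> \<and> d ((f ^^ n) z) y < \<delta>")
    case True
    then show ?thesis using reachesI_nearby[OF xy] by blast
  next
    case False
    then obtain \<delta>\<^sub>0 where \<delta>\<^sub>0: "\<delta>\<^sub>0 > 0"
      "\<not> (\<exists>z\<in>X. \<exists>n. d x z < \<delta>\<^sub>0 \<and> d ((f ^^ n) z) y < \<delta>\<^sub>0)"
      by blast
    have "\<exists>z\<in>X. \<exists>n. d y z < \<delta> \<and> d ((f ^^ n) z) x < \<delta>" if "\<delta> > 0" for \<delta>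
      using transit[of "min \<delta> \<delta>\<^sub>0"] \<delta>\<^sub>0 that by fastforce
    then show ?thesis
      using reachesI_nearby[OF xy(2,1)] reaches_sym[OF xy(2,1)] by blast
  qed
qed

lemma minimal_imp_transitive:
  assumes min: "minimal_system X d f"
  shows "topologically_transitive X d f"
  unfolding topologically_transitive_def
proof (intro allI impI, elim conjE)
  fix U V
  assume UV: "openin mtopology U" "U \<noteq> {}" "openin mtopology V" "V \<noteq> {}"
  then obtain x y where "x \<in> U" "y \<in> V" by blast
  moreover have "U \<subseteq> X" "V \<subseteq> X"
    using UV openin_subset by fastforce+
  ultimately have "y \<in> mtopology closure_of range (\<lambda>n. int_iter X f n x)" "x \<in> X"
    using min unfolding minimal_system_def by auto
  then obtain n where "int_iter X f n x \<in> V"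
    using UV(3) \<open>y \<in> V\<close> unfolding in_closure_of by blast
  then show "\<exists>n. U \<inter> {x \<in> X. int_iter X f n x \<in> V} \<noteq> {}"
    using \<open>x \<in> U\<close> \<open>x \<in> X\<close> by blast
qed

lemma all_reach_imp_minimal:
  assumes reach: "\<And>x y. \<lbrakk>x \<in> X; y \<in> X\<rbrakk> \<Longrightarrow> reaches x y"
  shows "minimal_system X d f"
  unfolding minimal_system_def
proof (intro ballI equalityI)
  fix x assume x: "x \<in> X"
  show "mtopology closure_of range (\<lambda>n. int_iter X f n x) \<subseteq> X"
    using closure_of_subset_topspace by fastforce
  show "X \<subseteq> mtopology closure_of range (\<lambda>n. int_iter X f n x)"
  proof
    fix y assume y: "y \<in> X"
    have "\<exists>w\<in>range (\<lambda>n. int_iter X f n x). w \<in> mball y \<epsilon>" if "\<epsilon> > 0" for \<epsilon>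
    proof -
      obtain n where "d ((f ^^ n) x) y < \<epsilon>"
        using reach[OF x y] \<open>\<epsilon> > 0\<close> unfolding reaches_def by blast
      then have "int_iter X f (int n) x \<in> mball y \<epsilon>"
        using x y by (simp add: int_iter_def commute)
      then show ?thesis by blast
    qed
    then show "y \<in> mtopology closure_of range (\<lambda>n. int_iter X f n x)"
      using y by (auto simp: metric_closure_of)
  qed
qed

section \<open>Gluing\<close>

lemma gluing_imp_all_reach:
  assumes glue: "gluing_orbit_property X d f" and xy: "x \<in> X" "y \<in> X"
  shows "reaches x y"
proof (rule reachesI_nearby[OF xy])
  fix \<delta> :: real
  assume "\<delta> > 0"
  let ?p = "\<lambda>j::nat. if j = 1 then x else y"
  have "orbit_sequence X 2 ?p (\<lambda>_. 1)"
    using xy by (simp add: orbit_sequence_def)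
  then obtain t z where z: "z \<in> X" "shadowed_by d f \<delta> 2 ?p (\<lambda>_. 1) t z"
    using glue \<open>\<delta> > 0\<close> unfolding gluing_orbit_property_def by meson
  have "d ((f ^^ start_time (\<lambda>_. 1) t j) z) (?p j) < \<delta>" if "j \<in> {1..2}" for j
    using z(2) that unfolding shadowed_by_def by fastforce
  from this[of 1] this[of 2]
  show "\<exists>z\<in>X. \<exists>n. d x z < \<delta> \<and> d ((f ^^ n) z) y < \<delta>"
    using z(1) by (auto simp: start_time_def commute)
qed

text \<open>
  The waiting times between the points of a finite net serve for all pairs of points, at the cost of
  one approximation at the start and one at the target.
\<close>

lemma uniform_waiting_time:
  assumes reach: "\<And>x y. \<lbrakk>x \<in> X; y \<in> X\<rbrakk> \<Longrightarrow> reaches x y" and "\<epsilon> > 0"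
  obtains N where "1 \<le> N"
    "\<And>x y. \<lbrakk>x \<in> X; y \<in> X\<rbrakk> \<Longrightarrow> \<exists>n\<in>{1..N}. d ((f ^^ n) x) y < \<epsilon>"
proof -
  obtain \<delta> where \<delta>: "\<delta> > 0" "\<delta> \<le> \<epsilon>/3"
    "\<And>x y n. \<lbrakk>x \<in> X; y \<in> X; d x y < \<delta>\<rbrakk> \<Longrightarrow> d ((f ^^ n) x) ((f ^^ n) y) < \<epsilon>/3"
    using equicontE[of "\<epsilon>/3"] \<open>\<epsilon> > 0\<close> by (metis divide_pos_pos zero_less_numeral)
  obtain K where K: "finite K" "K \<subseteq> X" "X \<subseteq> (\<Union>p\<in>K. mball p \<delta>)"
    using totally_bounded \<open>\<delta> > 0\<close> unfolding mtotally_bounded_def by meson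
  have "\<forall>p q. p \<in> X \<and> q \<in> X \<longrightarrow> (\<exists>n. d ((f ^^ n) p) q < \<delta>)"
    using reach \<open>\<delta> > 0\<close> unfolding reaches_def by blast
  then obtain w where w: "\<And>p q. \<lbrakk>p \<in> X; q \<in> X\<rbrakk> \<Longrightarrow> d ((f ^^ w p q) p) q < \<delta>"
    by metis
  define W where "W = Max (insert 0 ((\<lambda>(p, q). w p q) ` (K \<times> K)))"
  have W: "w p q \<le> W" if "p \<in> K" "q \<in> K" for p q
    unfolding W_def by (rule Max_ge) (use K(1) that in auto)
  have "\<exists>n\<in>{1..Suc W}. d ((f ^^ n) x) y < \<epsilon>" if xy: "x \<in> X" "y \<in> X" for x y
  proof -
    \<comment> \<open>A gap must be at least one, so the wait starts from \<open>f x\<close> instead of \<open>x\<close>.\<close>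
    have fx: "f x \<in> X" using surj xy by blast
    obtain p q where pq: "p \<in> K" "f x \<in> mball p \<delta>" "q \<in> K" "y \<in> mball q \<delta>"
      using K(3) fx xy by blast
    let ?n = "w p q"
    have pX: "p \<in> X" "q \<in> X" using pq K(2) by auto
    have "d ((f ^^ ?n) (f x)) ((f ^^ ?n) p) < \<epsilon>/3"
      using \<delta>(3) pq fx pX by (simp add: commute)
    moreover have "d ((f ^^ ?n) p) q < \<epsilon>/3" "d q y < \<epsilon>/3"
      using w[OF pX] pq \<delta>(2) by auto
    moreover have "d ((f ^^ ?n) (f x)) y \<le>
        d ((f ^^ ?n) (f x)) ((f ^^ ?n) p) + d ((f ^^ ?n) p) q + d q y"
      using triangle[of "(f ^^ ?n) (f x)" "(f ^^ ?n) p" y] triangle[of "(f ^^ ?n) p" q y]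
        fx pX xy by simp
    ultimately have "d ((f ^^ Suc ?n) x) y < \<epsilon>"
      by (simp add: funpow_swap1)
    moreover have "Suc ?n \<in> {1..Suc W}" using W pq by simp
    ultimately show ?thesis by blast
  qed
  then show thesis using that[of "Suc W"] by simp
qed

lemma start_time_Suc:
  "1 \<le> k \<Longrightarrow> start_time m t (Suc k) = start_time m t k + (m k + t k - 1)"
  by (simp add: start_time_def)

lemma start_time_fun_upd:
  "j \<le> k \<Longrightarrow> start_time m (t(k := n)) j = start_time m t j"
  unfolding start_time_def by (rule sum.cong) auto

text \<open>
  The gaps are chosen one after the other, each as the wait that starts at the last time of the
  current segment.
\<close>

lemma gaps_along_orbit:
  assumes wait: "\<And>x y. \<lbrakk>x \<in> X; y \<in> X\<rbrakk> \<Longrightarrow> \<exists>n\<in>{1..N}. d ((f ^^ n) x) y < \<delta>"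
    and "\<delta> > 0" and "orbit_sequence X k x m"
  shows "\<exists>t. (\<forall>j\<in>{1..<k}. t j \<in> {1..N}) \<and>
    (\<forall>j\<in>{1..k}. d ((f ^^ start_time m t j) (x 1)) (x j) < \<delta>)"
proof -
  have "1 \<le> k" using assms(3) by (simp add: orbit_sequence_def)
  then show ?thesis using assms(3)
  proof (induction k rule: dec_induct)
    case base
    then show ?case using \<open>\<delta> > 0\<close> by (simp add: orbit_sequence_def start_time_def)
  next
    case (step k)
    then have "orbit_sequence X k x m" by (simp add: orbit_sequence_def)
    then obtain t where t: "\<And>j. j \<in> {1..<k} \<Longrightarrow> t j \<in> {1..N}"
      "\<And>j. j \<in> {1..k} \<Longrightarrow> d ((f ^^ start_time m t j) (x 1)) (x j) < \<delta>"
      using step.IH by blast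
    have X: "x 1 \<in> X" "x (Suc k) \<in> X" "1 \<le> m k"
      using step.prems \<open>1 \<le> k\<close> by (auto simp: orbit_sequence_def)
    let ?s = "start_time m t k + (m k - 1)"
    obtain n where n: "n \<in> {1..N}" "d ((f ^^ n) ((f ^^ ?s) (x 1))) (x (Suc k)) < \<delta>"
      using wait[of "(f ^^ ?s) (x 1)" "x (Suc k)"] X by auto
    let ?t = "t(k := n)"
    have "start_time m ?t (Suc k) = n + ?s"
      using X(3) \<open>1 \<le> k\<close> by (simp add: start_time_Suc start_time_fun_upd)
    then have "d ((f ^^ start_time m ?t (Suc k)) (x 1)) (x (Suc k)) < \<delta>"
      using n(2) by (simp only: funpow_add o_apply)
    moreover have "d ((f ^^ start_time m ?t j) (x 1)) (x j) < \<delta>" if "j \<in> {1..k}" for j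
      using t(2)[OF that] that by (simp add: start_time_fun_upd)
    ultimately have "\<forall>j\<in>{1..Suc k}. d ((f ^^ start_time m ?t j) (x 1)) (x j) < \<delta>"
      by (metis atLeastAtMost_iff le_Suc_eq)
    moreover have "\<forall>j\<in>{1..<Suc k}. ?t j \<in> {1..N}"
      using t(1) n(1) by (auto simp: less_Suc_eq)
    ultimately show ?case by blast
  qed
qed

lemma all_reach_imp_gluing:
  assumes reach: "\<And>x y. \<lbrakk>x \<in> X; y \<in> X\<rbrakk> \<Longrightarrow> reaches x y"
  shows "gluing_orbit_property X d f"
  unfolding gluing_orbit_property_def
proof (intro allI impI)
  fix \<epsilon> :: real
  assume "\<epsilon> > 0"
  then obtain \<delta> where \<delta>: "\<delta> > 0"
    "\<And>x y n. \<lbrakk>x \<in> X; y \<in> X; d x y < \<delta>\<rbrakk> \<Longrightarrow> d ((f ^^ n) x) ((f ^^ n) y) < \<epsilon>"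
    using equicontE by metis
  obtain N where N: "1 \<le> N"
    "\<And>x y. \<lbrakk>x \<in> X; y \<in> X\<rbrakk> \<Longrightarrow> \<exists>n\<in>{1..N}. d ((f ^^ n) x) y < \<delta>"
    using uniform_waiting_time[OF reach \<open>\<delta> > 0\<close>] by metis
  have "\<exists>t. is_gap k t \<and> (\<forall>j\<in>{1..<k}. real (t j) \<le> real N) \<and>
      (\<exists>z\<in>X. shadowed_by d f \<epsilon> k x m t z)" if seq: "orbit_sequence X k x m" for k x m
  proof -
    obtain t where t: "\<forall>j\<in>{1..<k}. t j \<in> {1..N}"
      "\<And>j. j \<in> {1..k} \<Longrightarrow> d ((f ^^ start_time m t j) (x 1)) (x j) < \<delta>"
      using gaps_along_orbit[OF N(2) \<open>\<delta> > 0\<close> seq] by blast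
    have X: "x j \<in> X" if "j \<in> {1..k}" for j
      using seq that by (simp add: orbit_sequence_def)
    have x1: "x 1 \<in> X"
      using seq by (simp add: orbit_sequence_def)
    have "d ((f ^^ (start_time m t j + l)) (x 1)) ((f ^^ l) (x j)) < \<epsilon>" if "j \<in> {1..k}" for j l
    proof -
      have "d ((f ^^ l) ((f ^^ start_time m t j) (x 1))) ((f ^^ l) (x j)) < \<epsilon>"
        using \<delta>(2) t(2)[OF that] X[OF that] x1 by simp
      then show ?thesis
        by (simp only: funpow_add o_apply add.commute[of _ l])
    qed
    then have "shadowed_by d f \<epsilon> k x m t (x 1)"
      by (simp add: shadowed_by_def)
    then show ?thesis
      using t(1) x1 by (intro exI[of _ t]) (auto simp: is_gap_def)
  qed
  then show "\<exists>M::real. M > 0 \<and> (\<forall>k x m. orbit_sequence X k x m \<longrightarrow>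
      (\<exists>t. is_gap k t \<and> (\<forall>j\<in>{1..<k}. real (t j) \<le> M) \<and>
        (\<exists>z\<in>X. shadowed_by d f \<epsilon> k x m t z)))"
    using N(1) by (intro exI[of _ "real N"]) auto
qed

end

section \<open>The equivalence\<close>

theorem theorem1p3:
  fixes X :: "'a set" and d :: "'a \<Rightarrow> 'a \<Rightarrow> real" and f :: "'a \<Rightarrow> 'a"
  assumes "Metric_space X d"
    and "X \<noteq> {}"
    and "compact_space (Metric_space.mtopology X d)"
    and "homeomorphic_map (Metric_space.mtopology X d) (Metric_space.mtopology X d) f"
    and "equicontinuous_system X d f"
  shows "(topologically_transitive X d f \<longleftrightarrow> minimal_system X d f) \<and>
         (minimal_system X d f \<longleftrightarrow> gluing_orbit_property X d f)"
proof -
  interpret Metric_space X d by fact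
  interpret equicontinuous_surjection X d f
  proof
    show "mtotally_bounded X"
      using assms(3) compact_space_eq_mcomplete_mtotally_bounded by blast
    show "f ` X = X"
      using homeomorphic_imp_surjective_map[OF assms(4)] by simp
    show "equicontinuous_system X d f" by fact
  qed
  show ?thesis
    using transitive_imp_all_reach minimal_imp_transitive all_reach_imp_minimal
      gluing_imp_all_reach all_reach_imp_gluing by blast
qed

end
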